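(* Let $x=P(x)$ be a minPPS in simple normal form whose greatest fixed point satisfies $g^*<\mathbf{1}$, and let $j>0$ be an integer. If we run Generalized Newton's Method (GNM) starting at $x^{(0)}:=\mathbf{0}$ with rounding parameter $h=j+2+4|P|$, then after $h$ iterations we have $\|g^*-x^{(h)}\|_\infty\le2^{-j}$.
   Context: A minPPS in simple normal form (SNF) is a system $x_i=P_i(x)$, $i=1..n$, where each $P_i$ has one of the forms: L: $a_{i,0}+\sum_j a_{i,j}x_j$ with rational $a_{i,j}\ge0$, $\sum_{j\ge0}a_{i,j}\le1$; Q: $x_jx_k$; M: $\min\{x_j,x_k\}$. $g^*$ is the greatest fixed point in $[0,1]^n$; $|P|$ is the bit encoding size. For $y\in\mathbb{R}^n$, the linearization $P^y$ is defined by $P^y_i(x)=P_i(x)$ if $P_i$ has form L or M, and $P^y_i(x)=y_jx_k+x_jy_k-y_jy_k$ if $P_i(x)=x_jx_k$. For $\mathbf{0}\le y\le g^*$, $I(y)$ denotes the unique optimal solution $a\in\mathbb{R}^n$ of the program: maximize $\sum_ia_i$ subject to $P^y(a)\ge a$ (a linear program, since $\min\{a_j,a_k\}\ge a_i$ is equivalent to $a_j\ge a_i$, $a_k\ge a_i$). GNM with rounding parameter $h$: $x^{(0)}=\mathbf{0}$, and for $k\ge0$, $x^{(k+1)}_i$ is the largest non-negative integer multiple of $2^{-h}$ that is $\le\max\{0,I(x^{(k)})_i\}$, for each $i$. *)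

theory Defs
  imports "HOL-Analysis.Analysis" "HOL-Library.Log_Nat"
begin

datatype 'v snf_form =
    LinF rat "'v \<Rightarrow> rat"
  | QuadF 'v 'v
  | MinF 'v 'v

definition minPPS_SNF :: "('n::finite \<Rightarrow> 'n snf_form) \<Rightarrow> bool" where
  "minPPS_SNF P \<longleftrightarrow>
     (\<forall>i c a. P i = LinF c a \<longrightarrow> 0 \<le> c \<and> (\<forall>j. 0 \<le> a j) \<and> c + (\<Sum>j\<in>UNIV. a j) \<le> 1)"

fun eval_form :: "'n::finite snf_form \<Rightarrow> real ^ 'n \<Rightarrow> real" where
  "eval_form (LinF c a) x = of_rat c + (\<Sum>j\<in>UNIV. of_rat (a j) * x $ j)"
| "eval_form (QuadF j k) x = x $ j * x $ k"
| "eval_form (MinF j k) x = min (x $ j) (x $ k)"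

definition pps_map :: "('n::finite \<Rightarrow> 'n snf_form) \<Rightarrow> real ^ 'n \<Rightarrow> real ^ 'n" where
  "pps_map P x = (\<chi> i. eval_form (P i) x)"

text \<open>The order on \<^typ>\<open>real ^ 'n\<close> is the componentwise one, so \<open>{0..1}\<close> is the unit cube.\<close>

definition gfp_cube :: "('n::finite \<Rightarrow> 'n snf_form) \<Rightarrow> real ^ 'n" where
  "gfp_cube P = (GREATEST x. x \<in> {0..1} \<and> x = pps_map P x)"

text \<open>
  Encoding size: rationals are given by numerator and denominator (in lowest terms) in binary,
  variables by binary indices in the range \<open>1..n\<close>, and linear forms are stored sparsely.
  Separators and tags for the kind of an equation are not counted.
\<close>

definition nat_bits :: "nat \<Rightarrow> nat" where
  "nat_bits m = max 1 (floorlog 2 m)"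

definition rat_bits :: "rat \<Rightarrow> nat" where
  "rat_bits r = (case quotient_of r of (p, q) \<Rightarrow> nat_bits (nat \<bar>p\<bar>) + nat_bits (nat q))"

fun form_bits :: "'n::finite snf_form \<Rightarrow> nat" where
  "form_bits (LinF c a) =
     rat_bits c + (\<Sum>j | a j \<noteq> 0. nat_bits CARD('n) + rat_bits (a j))"
| "form_bits (QuadF j k) = 2 * nat_bits CARD('n)"
| "form_bits (MinF j k) = 2 * nat_bits CARD('n)"

definition enc_size :: "('n::finite \<Rightarrow> 'n snf_form) \<Rightarrow> nat" where
  "enc_size P = (\<Sum>i\<in>UNIV. form_bits (P i))"

fun lin_form :: "'n::finite snf_form \<Rightarrow> real ^ 'n \<Rightarrow> real ^ 'n \<Rightarrow> real" where
  "lin_form (QuadF j k) y x = y $ j * x $ k + x $ j * y $ k - y $ j * y $ k"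
| "lin_form f y x = eval_form f x"

definition linearization ::
    "('n::finite \<Rightarrow> 'n snf_form) \<Rightarrow> real ^ 'n \<Rightarrow> real ^ 'n \<Rightarrow> real ^ 'n" where
  "linearization P y x = (\<chi> i. lin_form (P i) y x)"

definition gnm_I :: "('n::finite \<Rightarrow> 'n snf_form) \<Rightarrow> real ^ 'n \<Rightarrow> real ^ 'n" where
  "gnm_I P y =
     (THE a. is_arg_max (\<lambda>a. \<Sum>i\<in>UNIV. a $ i) (\<lambda>a. linearization P y a \<ge> a) a)"

definition round_down :: "nat \<Rightarrow> real \<Rightarrow> real" where
  "round_down h t = (GREATEST r. (\<exists>m::nat. r = real m * 2 powr (- real h)) \<and> r \<le> t)"

primrec gnm :: "('n::finite \<Rightarrow> 'n snf_form) \<Rightarrow> nat \<Rightarrow> nat \<Rightarrow> real ^ 'n" where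
  "gnm P h 0 = 0"
| "gnm P h (Suc k) = (\<chi> i. round_down h (max 0 (gnm_I P (gnm P h k) $ i)))"

end

theory Submission
  imports Defs
begin

text \<open>
  Write \<open>g\<close> for the greatest fixed point and \<open>v = 1 - g > 0\<close>. If \<open>0 \<le> y \<le> g\<close> and
  \<open>g - y \<le> \<kappa> v\<close>, then \<open>g - (\<kappa>/2) v\<close> is feasible for the linear program at \<open>y\<close>: for a product
  \<open>x\<^sub>j x\<^sub>k\<close> the quadratic error \<open>(\<kappa>/2)\<^sup>2 v\<^sub>j v\<^sub>k\<close> of the linearization cancels. Every feasible point
  lies below \<open>g\<close>, and by monotonicity the feasible points have a greatest element, which is
  \<open>I(y)\<close>. So an exact step halves \<open>\<kappa>\<close>, and rounding adds at most \<open>2\<^sup>-\<^sup>h / min v\<close>, where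
  \<open>v \<ge> 2\<^sup>-\<^sup>|\<^sup>P\<^sup>|\<close>.

  The bound on \<open>v\<close> and the bound \<open>a \<le> g\<close> on feasible points are both proved by contradiction: a
  violation yields a set of variables on which \<open>g\<close> can be raised to a post-fixed point in the
  cube, which Knaster--Tarski forbids. No optimal policies are needed.
\<close>

lemma vec_lub_exists:
  fixes A :: "(real ^ 'n) set"
  assumes "A \<noteq> {}" and "\<And>a. a \<in> A \<Longrightarrow> a \<le> u"
  obtains s where "\<And>a. a \<in> A \<Longrightarrow> a \<le> s" and "\<And>b. (\<And>a. a \<in> A \<Longrightarrow> a \<le> b) \<Longrightarrow> s \<le> b"
proof
  let ?s = "\<chi> i. Sup ((\<lambda>a. a $ i) ` A)"
  show "a \<le> ?s" if "a \<in> A" for a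
    unfolding less_eq_vec_def
  proof
    fix i
    have "bdd_above ((\<lambda>a. a $ i) ` A)"
      using assms(2) by (auto simp: less_eq_vec_def intro!: bdd_aboveI2[of _ _ "u $ i"])
    then show "a $ i \<le> ?s $ i" using that by (auto intro: cSup_upper)
  qed
  show "?s \<le> b" if "\<And>a. a \<in> A \<Longrightarrow> a \<le> b" for b
    using assms(1) that by (auto simp: less_eq_vec_def intro!: cSup_least)
qed

lemma pps_map_mono:
  assumes "minPPS_SNF P" "0 \<le> x" "x \<le> y"
  shows "pps_map P x \<le> pps_map P y"
  unfolding less_eq_vec_def
proof
  fix i
  have x: "0 \<le> x $ j" "x $ j \<le> y $ j" for j
    using assms by (auto simp: less_eq_vec_def)
  show "pps_map P x $ i \<le> pps_map P y $ i"
  proof (cases "P i")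
    case (LinF c a)
    with assms(1) have "0 \<le> a j" for j by (auto simp: minPPS_SNF_def)
    then show ?thesis using x
      by (auto simp: pps_map_def LinF intro!: sum_mono mult_left_mono)
  next
    case (QuadF j k)
    show ?thesis using x[of j] x[of k] by (auto simp: pps_map_def QuadF intro!: mult_mono)
  next
    case (MinF j k)
    show ?thesis using x[of j] x[of k] by (auto simp: pps_map_def MinF)
  qed
qed

lemma linearization_mono:
  assumes "minPPS_SNF P" "0 \<le> y" "a \<le> b"
  shows "linearization P y a \<le> linearization P y b"
  unfolding less_eq_vec_def
proof
  fix i
  have a: "0 \<le> y $ j" "a $ j \<le> b $ j" for j
    using assms by (auto simp: less_eq_vec_def)
  show "linearization P y a $ i \<le> linearization P y b $ i"
  proof (cases "P i")
    case (LinF c \<alpha>)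
    with assms(1) have "0 \<le> \<alpha> j" for j by (auto simp: minPPS_SNF_def)
    then show ?thesis using a
      by (auto simp: linearization_def LinF intro!: sum_mono mult_left_mono)
  next
    case (QuadF j k)
    show ?thesis using a[of j] a[of k]
      by (auto simp: linearization_def QuadF intro!: add_mono mult_left_mono mult_right_mono)
  next
    case (MinF j k)
    show ?thesis using a[of j] a[of k] by (auto simp: linearization_def MinF)
  qed
qed

lemma LinF_of_rat:
  assumes "minPPS_SNF P" "P i = LinF c a"
  shows "0 \<le> (of_rat c :: real)" "\<And>j. 0 \<le> (of_rat (a j) :: real)"
    "of_rat c + (\<Sum>j\<in>UNIV. of_rat (a j) :: real) \<le> 1"
proof -
  have "0 \<le> c" "\<And>j. 0 \<le> a j" and s: "c + (\<Sum>j\<in>UNIV. a j) \<le> 1"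
    using assms by (auto simp: minPPS_SNF_def)
  then show "0 \<le> (of_rat c :: real)" "\<And>j. 0 \<le> (of_rat (a j) :: real)" by auto
  have "of_rat (c + (\<Sum>j\<in>UNIV. a j)) \<le> (of_rat 1 :: real)"
    using s by (simp only: of_rat_less_eq)
  then show "of_rat c + (\<Sum>j\<in>UNIV. of_rat (a j) :: real) \<le> 1"
    by (simp add: of_rat_add of_rat_sum)
qed

lemma pps_map_le_1:
  assumes P: "minPPS_SNF P" and "0 \<le> x" "x \<le> 1"
  shows "pps_map P x \<le> 1"
proof -
  have "pps_map P x \<le> pps_map P 1" using pps_map_mono[OF P] assms by blast
  also have "\<dots> \<le> 1"
    unfolding less_eq_vec_def
  proof
    fix i
    show "pps_map P 1 $ i \<le> 1 $ i"
      using LinF_of_rat(3)[OF P, of i] by (cases "P i") (auto simp: pps_map_def)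
  qed
  finally show ?thesis .
qed

lemma pps_map_nonneg:
  assumes P: "minPPS_SNF P" and "0 \<le> x"
  shows "0 \<le> pps_map P x"
proof -
  have "0 \<le> pps_map P 0"
    unfolding less_eq_vec_def
  proof
    fix i
    show "0 $ i \<le> pps_map P 0 $ i"
      using LinF_of_rat(1)[OF P, of i] by (cases "P i") (auto simp: pps_map_def)
  qed
  also have "\<dots> \<le> pps_map P x" using pps_map_mono[OF P] assms by blast
  finally show ?thesis .
qed

lemma gfp_cube:
  assumes P: "minPPS_SNF P"
  shows "0 \<le> gfp_cube P" "gfp_cube P \<le> 1" "pps_map P (gfp_cube P) = gfp_cube P"
    "\<And>x. 0 \<le> x \<Longrightarrow> x \<le> 1 \<Longrightarrow> x \<le> pps_map P x \<Longrightarrow> x \<le> gfp_cube P"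
proof -
  let ?A = "{x. 0 \<le> x \<and> x \<le> 1 \<and> x \<le> pps_map P x}"
  have z: "0 \<in> ?A" using pps_map_nonneg[OF P] by (auto simp: less_eq_vec_def)
  obtain s where ub: "\<And>a. a \<in> ?A \<Longrightarrow> a \<le> s"
    and least: "\<And>b. (\<And>a. a \<in> ?A \<Longrightarrow> a \<le> b) \<Longrightarrow> s \<le> b"
    using vec_lub_exists[of ?A 1] z by blast
  have s0: "0 \<le> s" using ub z by blast
  have s1: "s \<le> 1" using least[of 1] by blast
  have sP: "s \<le> pps_map P s"
  proof (rule least)
    fix a assume a: "a \<in> ?A"
    then have "pps_map P a \<le> pps_map P s" using pps_map_mono[OF P] ub by blast
    then show "a \<le> pps_map P s" using a order_trans by blast
  qed
  have "pps_map P s \<in> ?A"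
    using pps_map_nonneg[OF P s0] pps_map_le_1[OF P s0 s1] pps_map_mono[OF P s0 sP] by auto
  then have sfix: "s = pps_map P s" using ub sP by (intro antisym) auto
  have "gfp_cube P = s" unfolding gfp_cube_def
  proof (rule Greatest_equality)
    show "s \<in> {0..1} \<and> s = pps_map P s" using s0 s1 sfix by auto
    show "x \<le> s" if "x \<in> {0..1} \<and> x = pps_map P x" for x
      using ub[of x] that by auto
  qed
  then show "0 \<le> gfp_cube P" "gfp_cube P \<le> 1" "pps_map P (gfp_cube P) = gfp_cube P"
    "\<And>x. 0 \<le> x \<Longrightarrow> x \<le> 1 \<Longrightarrow> x \<le> pps_map P x \<Longrightarrow> x \<le> gfp_cube P"
    using s0 s1 sfix ub by auto
qed

definition has_denom_bits :: "rat \<Rightarrow> nat \<Rightarrow> bool" where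
  "has_denom_bits r N \<longleftrightarrow> (\<exists>q::int. 0 < q \<and> q \<le> 2 ^ N \<and> r * of_int q \<in> \<int>)"

lemma has_denom_bits_add:
  assumes "has_denom_bits r M" "has_denom_bits s N"
  shows "has_denom_bits (r + s) (M + N)"
proof -
  obtain p q :: int where p: "0 < p" "p \<le> 2 ^ M" "r * of_int p \<in> \<int>"
    and q: "0 < q" "q \<le> 2 ^ N" "s * of_int q \<in> \<int>"
    using assms unfolding has_denom_bits_def by blast
  have "(r + s) * of_int (p * q) = (r * of_int p) * of_int q + (s * of_int q) * of_int p"
    by (simp add: algebra_simps)
  also have "\<dots> \<in> \<int>" using p q by auto
  finally have "(r + s) * of_int (p * q) \<in> \<int>" .
  moreover have "p * q \<le> 2 ^ (M + N)"
    using p q by (simp add: power_add mult_mono)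
  ultimately show ?thesis using p q unfolding has_denom_bits_def
    by (intro exI[of _ "p * q"]) auto
qed

lemma has_denom_bits_mono:
  assumes "has_denom_bits r M" "M \<le> N"
  shows "has_denom_bits r N"
proof -
  have "(2::int) ^ M \<le> 2 ^ N" using assms(2) by simp
  then show ?thesis using assms(1) order_trans unfolding has_denom_bits_def by blast
qed

lemma has_denom_bits_uminus: "has_denom_bits r N \<Longrightarrow> has_denom_bits (- r) N"
  unfolding has_denom_bits_def by auto

lemma has_denom_bits_of_int: "has_denom_bits (of_int k) 0"
  unfolding has_denom_bits_def by (intro exI[of _ 1]) auto

lemma has_denom_bits_sum:
  assumes "finite J" "\<And>j. j \<in> J \<Longrightarrow> has_denom_bits (f j) (b j)"
  shows "has_denom_bits (\<Sum>j\<in>J. f j) (\<Sum>j\<in>J. b j)"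
  using assms
proof (induction J rule: finite_induct)
  case empty
  show ?case using has_denom_bits_of_int[of 0] by simp
next
  case (insert x J)
  then show ?case by (simp add: has_denom_bits_add)
qed

lemma has_denom_bits_rat_bits: "has_denom_bits r (rat_bits r)"
proof -
  obtain p q where pq: "quotient_of r = (p, q)" by fastforce
  have q: "0 < q" using quotient_of_denom_pos[OF pq] .
  have "nat q < 2 ^ floorlog 2 (nat q)" using floorlog_bounds[of "nat q" 2] q by auto
  also have "(2::nat) ^ floorlog 2 (nat q) \<le> 2 ^ rat_bits r"
    by (intro power_increasing) (auto simp: rat_bits_def pq nat_bits_def)
  finally have "int (nat q) < int (2 ^ rat_bits r)" by linarith
  then have "q \<le> 2 ^ rat_bits r" using q by simp
  moreover have "r * of_int q \<in> \<int>" using quotient_of_div[OF pq] q by simp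
  ultimately show ?thesis using q unfolding has_denom_bits_def by blast
qed

lemma has_denom_bits_lower_bound:
  assumes "has_denom_bits r N" "0 < r"
  shows "(1/2) ^ N \<le> (of_rat r :: real)"
proof -
  obtain q :: int where q: "0 < q" "q \<le> 2 ^ N" "r * of_int q \<in> \<int>"
    using assms(1) unfolding has_denom_bits_def by blast
  then obtain k :: int where k: "r * of_int q = of_int k" by (auto elim: Ints_cases)
  have "0 < r * of_int q" using q assms(2) by simp
  then have "1 \<le> k" unfolding k by simp
  have qN: "real_of_int q \<le> 2 ^ N"
    using q(2) by (metis of_int_le_iff of_int_numeral of_int_power)
  have "of_rat r * real_of_int q = of_rat (r * of_int q)" by (simp add: of_rat_mult)
  also have "\<dots> = of_int k" unfolding k by simp
  finally have "1 \<le> of_rat r * real_of_int q" using \<open>1 \<le> k\<close> by simp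
  also have "\<dots> \<le> of_rat r * 2 ^ N" using qN assms(2) by (intro mult_left_mono) auto
  finally show ?thesis by (simp add: power_divide field_simps)
qed

lemma LinF_coeff_lower_bound:
  fixes a :: "'n::finite \<Rightarrow> rat"
  assumes "0 < a j"
  shows "(1/2) ^ form_bits (LinF c a) \<le> (of_rat (a j) :: real)"
proof (rule has_denom_bits_lower_bound[OF has_denom_bits_mono[OF has_denom_bits_rat_bits] assms])
  have "rat_bits (a j) \<le> nat_bits CARD('n) + rat_bits (a j)" by simp
  also have "\<dots> \<le> (\<Sum>j | a j \<noteq> 0. nat_bits CARD('n) + rat_bits (a j))"
    using assms by (intro member_le_sum) auto
  finally show "rat_bits (a j) \<le> form_bits (LinF c a)" by simp
qed

lemma LinF_deficit_lower_bound:
  fixes a :: "'n::finite \<Rightarrow> rat"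
  assumes "c + (\<Sum>j\<in>UNIV. a j) < 1"
  shows "(1/2) ^ form_bits (LinF c a) \<le> 1 - of_rat c - (\<Sum>j\<in>UNIV. of_rat (a j) :: real)"
proof -
  let ?s = "\<Sum>j | a j \<noteq> 0. a j"
  have s: "?s = (\<Sum>j\<in>UNIV. a j)" by (intro sum.mono_neutral_left) auto
  have "has_denom_bits ?s (\<Sum>j | a j \<noteq> 0. nat_bits CARD('n) + rat_bits (a j))"
    by (intro has_denom_bits_sum has_denom_bits_mono[OF has_denom_bits_rat_bits]) auto
  then have "has_denom_bits (of_int 1 + - (c + ?s)) (0 + form_bits (LinF c a))"
    unfolding form_bits.simps
    by (intro has_denom_bits_add has_denom_bits_uminus has_denom_bits_of_int
        has_denom_bits_rat_bits)
  then have "has_denom_bits (1 - (c + ?s)) (form_bits (LinF c a))" by (simp add: algebra_simps)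
  then have "(1/2) ^ form_bits (LinF c a) \<le> (of_rat (1 - (c + ?s)) :: real)"
    using assms s by (intro has_denom_bits_lower_bound) auto
  then show ?thesis by (simp add: s of_rat_diff of_rat_add of_rat_sum algebra_simps)
qed

lemma gfp_cube_exit:
  assumes P: "minPPS_SNF P" and lt1: "\<forall>i. gfp_cube P $ i < 1" and "D \<noteq> UNIV"
  shows "\<exists>i. i \<notin> D \<and>
    ((\<exists>c a. P i = LinF c a \<and> (c + (\<Sum>j\<in>UNIV. a j) < 1 \<or> (\<exists>j\<in>D. 0 < a j))) \<or>
     (\<exists>j k. (P i = QuadF j k \<or> P i = MinF j k) \<and> (j \<in> D \<or> k \<in> D)))"
    (is "\<exists>i. i \<notin> D \<and> ?exit i")
proof (rule ccontr)
  assume "\<not> ?thesis"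
  then have stuck: "\<not> ?exit i" if "i \<notin> D" for i using that by blast
  let ?g = "gfp_cube P"
  define x where "x = (\<chi> i. if i \<in> D then ?g $ i else 1)"
  have gx: "?g \<le> x" using lt1 by (auto simp: x_def less_eq_vec_def intro: less_imp_le)
  have x0: "0 \<le> x" using gx gfp_cube(1)[OF P] by (rule order_trans[rotated])
  have x1: "x \<le> 1" using lt1 by (auto simp: x_def less_eq_vec_def intro: less_imp_le)
  have "x \<le> pps_map P x" unfolding less_eq_vec_def
  proof
    fix i
    show "x $ i \<le> pps_map P x $ i"
    proof (cases "i \<in> D")
      case True
      have "pps_map P ?g \<le> pps_map P x" using pps_map_mono[OF P gfp_cube(1)[OF P] gx] .
      then have "?g $ i \<le> pps_map P x $ i"
        unfolding gfp_cube(3)[OF P] by (simp add: less_eq_vec_def)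
      then show ?thesis using True by (simp add: x_def)
    next
      case False
      note st = stuck[OF False]
      show ?thesis
      proof (cases "P i")
        case (LinF c a)
        have a: "0 \<le> a j" "c + (\<Sum>j\<in>UNIV. a j) \<le> 1" for j
          using P LinF by (auto simp: minPPS_SNF_def)
        have c1: "c + (\<Sum>j\<in>UNIV. a j) = 1" and "\<And>j. j \<in> D \<Longrightarrow> \<not> 0 < a j"
          using st LinF a(2) by (fastforce, blast)
        then have "j \<in> D \<Longrightarrow> a j = 0" for j using a(1)[of j] by (simp add: order_less_le)
        then have "(\<Sum>j\<in>UNIV. of_rat (a j) * x $ j) = (\<Sum>j\<in>UNIV. (of_rat (a j) :: real))"
          by (intro sum.cong) (auto simp: x_def)
        then have "pps_map P x $ i = of_rat (c + (\<Sum>j\<in>UNIV. a j))"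
          by (simp add: pps_map_def LinF of_rat_add of_rat_sum)
        then show ?thesis using False c1 by (simp add: x_def)
      next
        case (QuadF j k)
        then show ?thesis using st False by (simp add: pps_map_def x_def)
      next
        case (MinF j k)
        then show ?thesis using st False by (simp add: pps_map_def x_def)
      qed
    qed
  qed
  then have xg: "x \<le> ?g" using gfp_cube(4)[OF P x0 x1] by blast
  obtain i where "i \<notin> D" using assms(3) by blast
  moreover have "x $ i \<le> ?g $ i" using xg by (simp add: less_eq_vec_def)
  ultimately show False using lt1[rule_format, of i] by (simp add: x_def)
qed

text \<open>
  Each equation is entered into \<open>D\<close> through a single variable already in \<open>D\<close> or through its
  probability deficit, so it costs one factor \<open>2\<^sup>-\<^sup>b\<close>, where \<open>b\<close> is its own encoding size.
  This gives \<open>2\<^sup>-\<^sup>|\<^sup>P\<^sup>|\<close>, better than the \<open>2\<^sup>-\<^sup>4\<^sup>|\<^sup>P\<^sup>|\<close> that the theorem allows for.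
\<close>

lemma gfp_cube_gap:
  assumes P: "minPPS_SNF P" and lt1: "\<forall>i. gfp_cube P $ i < 1"
  shows "(1/2) ^ enc_size P \<le> 1 - gfp_cube P $ i"
proof -
  let ?g = "gfp_cube P"
  let ?w = "\<lambda>D. (1/2) ^ (\<Sum>l\<in>D. form_bits (P l)) :: real"
  have g: "0 \<le> ?g $ i" "?g $ i \<le> 1" "?g $ i = eval_form (P i) ?g" for i
    using gfp_cube[OF P] by (auto simp: less_eq_vec_def pps_map_def vec_eq_iff)
  have ex: "\<exists>D. card D = m \<and> (\<forall>i\<in>D. ?w D \<le> 1 - ?g $ i)" if "m \<le> CARD('a)" for m
    using that
  proof (induction m)
    case 0
    show ?case by (intro exI[of _ "{}"]) auto
  next
    case (Suc m)
    then obtain D where D: "card D = m" "\<And>i. i \<in> D \<Longrightarrow> ?w D \<le> 1 - ?g $ i" by auto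
    have "D \<noteq> UNIV" using D(1) Suc.prems by auto
    from gfp_cube_exit[OF P lt1 this] obtain i where i: "i \<notin> D" and ex:
      "(\<exists>c a. P i = LinF c a \<and> (c + (\<Sum>j\<in>UNIV. a j) < 1 \<or> (\<exists>j\<in>D. 0 < a j))) \<or>
       (\<exists>j k. (P i = QuadF j k \<or> P i = MinF j k) \<and> (j \<in> D \<or> k \<in> D))" by blast
    have wi: "?w (insert i D) = (1/2) ^ form_bits (P i) * ?w D"
      using i by (simp add: power_add)
    have p1: "(1/2::real) ^ n \<le> 1" for n by (simp add: power_le_one)
    have wD: "?w (insert i D) \<le> ?w D"
      unfolding wi using p1[of "form_bits (P i)"] by (intro mult_left_le_one_le) auto
    have wb: "?w (insert i D) \<le> (1/2) ^ form_bits (P i)"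
      unfolding wi using p1[of "\<Sum>l\<in>D. form_bits (P l)"] by (intro mult_right_le_one_le) auto
    have "?w (insert i D) \<le> 1 - ?g $ i"
    proof (cases "P i")
      case (LinF c a)
      let ?a = "\<lambda>j. of_rat (a j) :: real"
      note L = LinF_of_rat[OF P LinF]
      have gi: "1 - ?g $ i = (1 - of_rat c - (\<Sum>j\<in>UNIV. ?a j)) + (\<Sum>j\<in>UNIV. ?a j * (1 - ?g $ j))"
        using g(3)[of i] by (simp add: LinF algebra_simps sum_subtractf)
      have nn: "0 \<le> ?a j * (1 - ?g $ j)" for j using L(2) g(2)[of j] by simp
      consider "c + (\<Sum>j\<in>UNIV. a j) < 1" | j where "j \<in> D" "0 < a j"
        using ex LinF by auto
      then show ?thesis
      proof cases
        case 1
        have "0 \<le> (\<Sum>j\<in>UNIV. ?a j * (1 - ?g $ j))" using nn by (intro sum_nonneg) auto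
        then show ?thesis using LinF_deficit_lower_bound[OF 1] wb[unfolded LinF] gi by linarith
      next
        case 2
        have "?w (insert i D) \<le> ?a j * (1 - ?g $ j)"
          unfolding wi LinF using LinF_coeff_lower_bound[of a j c] D(2)[of j] 2 L(2)
          by (intro mult_mono) auto
        also have "\<dots> \<le> (\<Sum>j\<in>UNIV. ?a j * (1 - ?g $ j))"
          using nn by (intro member_le_sum) auto
        finally show ?thesis using gi L(3) by linarith
      qed
    next
      case (QuadF j k)
      have "?g $ i \<le> ?g $ j" "?g $ i \<le> ?g $ k"
        using g(1,2)[of j] g(1,2)[of k] g(3)[of i] QuadF
        by (auto intro: mult_left_le mult_left_le_one_le)
      moreover have "j \<in> D \<or> k \<in> D" using ex QuadF by auto
      ultimately show ?thesis using D(2)[of j] D(2)[of k] wD by linarith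
    next
      case (MinF j k)
      have "?g $ i \<le> ?g $ j" "?g $ i \<le> ?g $ k" using g(3)[of i] MinF by auto
      moreover have "j \<in> D \<or> k \<in> D" using ex MinF by auto
      ultimately show ?thesis using D(2)[of j] D(2)[of k] wD by linarith
    qed
    then have "\<forall>l\<in>insert i D. ?w (insert i D) \<le> 1 - ?g $ l"
      using order_trans[OF wD D(2)] by blast
    moreover have "card (insert i D) = Suc m" using i D(1) by simp
    ultimately show ?case by blast
  qed
  obtain D where "card D = CARD('a)" "\<forall>i\<in>D. ?w D \<le> 1 - ?g $ i" using ex[of "CARD('a)"] by auto
  moreover from this have "D = UNIV" by (simp add: card_eq_UNIV_imp_eq_UNIV)
  ultimately show ?thesis by (simp add: enc_size_def)
qed

lemma linearization_postfixed_le_gfp_cube: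
  assumes P: "minPPS_SNF P" and lt1: "\<forall>i. gfp_cube P $ i < 1"
    and y: "0 \<le> y" "y \<le> gfp_cube P" and a: "a \<le> linearization P y a"
  shows "a \<le> gfp_cube P"
proof (rule ccontr)
  assume na: "\<not> ?thesis"
  define g where "g = gfp_cube P"
  define v where "v i = 1 - g $ i" for i
  define r where "r i = (a $ i - g $ i) / v i" for i
  define m where "m = Max (range r)"
  define S where "S = {i. r i = m}"
  \<comment> \<open>\<open>S\<close> contains no product equation; on the minimizers \<open>T\<close> of \<open>g\<close> in \<open>S\<close>, chosen below, linear
    equations are averages over \<open>T\<close>, so \<open>g\<close> can be raised uniformly by \<open>\<epsilon>\<close> on \<open>T\<close>.\<close>
  have g: "0 \<le> g $ i" "g $ i < 1" "eval_form (P i) g = g $ i" for i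
    using gfp_cube[OF P] lt1
    by (auto simp: g_def less_eq_vec_def pps_map_def vec_eq_iff)
  have v: "0 < v i" for i using g(2) by (simp add: v_def)
  have yg: "0 \<le> y $ i" "y $ i \<le> g $ i" for i
    using y by (auto simp: g_def less_eq_vec_def)
  have ai: "a $ i \<le> lin_form (P i) y a" for i
    using a by (simp add: linearization_def less_eq_vec_def)
  obtain i0 where "g $ i0 < a $ i0" using na by (auto simp: g_def less_eq_vec_def not_le)
  then have "0 < r i0" using v by (simp add: r_def)
  moreover have rm: "r i \<le> m" for i by (simp add: m_def)
  ultimately have m: "0 < m" using order_less_le_trans by blast
  have ub: "a $ i \<le> g $ i + m * v i" for i
    using rm[of i] v[of i] by (simp add: r_def field_simps)
  have S: "i \<in> S \<longleftrightarrow> g $ i + m * v i \<le> a $ i" for i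
    using ub[of i] v[of i] by (auto simp: S_def r_def field_simps)
  have "m \<in> range r" unfolding m_def by (intro Max_in) auto
  then have Sne: "S \<noteq> {}" by (auto simp: S_def)
  define \<gamma> where "\<gamma> = Min ((\<lambda>i. g $ i) ` S)"
  define T where "T = {i\<in>S. g $ i = \<gamma>}"
  have "\<gamma> \<in> (\<lambda>i. g $ i) ` S" unfolding \<gamma>_def using Sne by (intro Min_in) auto
  then obtain t where t: "t \<in> T" by (auto simp: T_def)
  have \<gamma>min: "\<gamma> \<le> g $ i" if "i \<in> S" for i using that by (simp add: \<gamma>_def)
  define E where "E = insert (1 - \<gamma>) ((\<lambda>k. g $ k - \<gamma>) ` {k. \<gamma> < g $ k})"
  define \<epsilon> where "\<epsilon> = Min E"
  have \<gamma>1: "\<gamma> < 1" using t g(2)[of t] by (auto simp: T_def)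
  have "\<epsilon> \<in> E" unfolding \<epsilon>_def by (intro Min_in) (auto simp: E_def)
  then have \<epsilon>: "0 < \<epsilon>" using \<gamma>1 by (auto simp: E_def)
  have \<epsilon>1: "\<epsilon> \<le> 1 - \<gamma>" by (simp add: \<epsilon>_def E_def)
  have \<epsilon>k: "\<gamma> + \<epsilon> \<le> g $ k" if "\<gamma> < g $ k" for k
  proof -
    have "\<epsilon> \<le> g $ k - \<gamma>" unfolding \<epsilon>_def using that by (intro Min_le) (auto simp: E_def)
    then show ?thesis by simp
  qed
  define x where "x = (\<chi> i. if i \<in> T then g $ i + \<epsilon> else g $ i)"
  have gx: "g \<le> x" using \<epsilon> by (auto simp: x_def less_eq_vec_def)
  have x0: "0 \<le> x" using gx g(1) by (auto simp: less_eq_vec_def intro: order_trans)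
  have x1: "x \<le> 1" using \<epsilon>1 less_imp_le[OF g(2)] by (auto simp: x_def less_eq_vec_def T_def)
  have "x \<le> pps_map P x" unfolding less_eq_vec_def
  proof
    fix i
    show "x $ i \<le> pps_map P x $ i"
    proof (cases "i \<in> T")
      case False
      have "pps_map P g \<le> pps_map P x"
        using pps_map_mono[OF P _ gx] g(1) by (simp add: less_eq_vec_def)
      then have "pps_map P g $ i \<le> pps_map P x $ i" by (simp add: less_eq_vec_def)
      then show ?thesis using False g(3) by (simp add: x_def pps_map_def)
    next
      case True
      then have iS: "g $ i + m * v i \<le> a $ i" and gi: "g $ i = \<gamma>" by (auto simp: T_def S)
      have xi: "x $ i = \<gamma> + \<epsilon>" using True gi by (simp add: x_def)
      show ?thesis
      proof (cases "P i")
        case (LinF c \<alpha>)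
        let ?b = "\<lambda>j. of_rat (\<alpha> j) :: real"
        note L = LinF_of_rat[OF P LinF]
        have gL: "g $ i = of_rat c + (\<Sum>j\<in>UNIV. ?b j * g $ j)" using g(3)[of i] LinF by simp
        have bv: "(\<Sum>j\<in>UNIV. ?b j * v j) = (\<Sum>j\<in>UNIV. ?b j) - (g $ i - of_rat c)"
          using gL by (simp add: v_def algebra_simps sum_subtractf)
        have gap: "(\<Sum>j\<in>UNIV. ?b j * (g $ j + m * v j - a $ j)) \<le> m * ((\<Sum>j\<in>UNIV. ?b j * v j) - v i)"
          using iS ai[of i] gL
          by (simp add: LinF algebra_simps sum_subtractf sum.distrib sum_distrib_left)
        have nn: "0 \<le> ?b j * (g $ j + m * v j - a $ j)" for j using L(2) ub[of j] by simp
        have le: "(\<Sum>j\<in>UNIV. ?b j * v j) \<le> v i" using bv L(3) by (simp add: v_def)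
        have "0 \<le> (\<Sum>j\<in>UNIV. ?b j * (g $ j + m * v j - a $ j))"
          using nn by (intro sum_nonneg) auto
        then have "0 \<le> m * ((\<Sum>j\<in>UNIV. ?b j * v j) - v i)" using gap by linarith
        then have eq: "(\<Sum>j\<in>UNIV. ?b j * v j) = v i"
          using le m by (simp add: zero_le_mult_iff)
        have "(\<Sum>j\<in>UNIV. ?b j * (g $ j + m * v j - a $ j)) = 0"
          using gap eq \<open>0 \<le> sum _ _\<close> by simp
        then have "?b j * (g $ j + m * v j - a $ j) = 0" for j
          using nn by (subst (asm) sum_nonneg_eq_0_iff) auto
        then have inS: "j \<in> S" if "?b j \<noteq> 0" for j
          using that unfolding S by (metis eq_iff_diff_eq_0 mult_eq_0_iff order_refl)
        have nn2: "0 \<le> ?b j * (v i - v j)" for j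
        proof (cases "?b j = 0")
          case False
          then have "v j \<le> v i" using \<gamma>min[OF inS] gi by (simp add: v_def)
          then show ?thesis using L(2)[of j] by simp
        qed simp
        have s2: "(\<Sum>j\<in>UNIV. ?b j * (v i - v j)) = (\<Sum>j\<in>UNIV. ?b j) * v i - v i"
          using eq by (simp add: right_diff_distrib sum_subtractf sum_distrib_right)
        have "0 \<le> (\<Sum>j\<in>UNIV. ?b j * (v i - v j))" using nn2 by (intro sum_nonneg) auto
        then have "v i \<le> (\<Sum>j\<in>UNIV. ?b j) * v i" using s2 by simp
        then have "1 \<le> (\<Sum>j\<in>UNIV. ?b j)" using v[of i] by simp
        then have b1: "(\<Sum>j\<in>UNIV. ?b j) = 1" using L(1,3) by linarith
        have "(\<Sum>j\<in>UNIV. ?b j * (v i - v j)) = 0" using s2 b1 by simp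
        then have z2: "?b j * (v i - v j) = 0" for j
          using nn2 by (subst (asm) sum_nonneg_eq_0_iff) auto
        then have inT: "j \<in> T" if "?b j \<noteq> 0" for j
          using that inS[OF that] gi z2[of j] by (simp add: T_def v_def)
        have "(\<Sum>j\<in>UNIV. ?b j * x $ j) = (\<Sum>j\<in>UNIV. ?b j * g $ j + ?b j * \<epsilon>)"
          using inT by (intro sum.cong) (auto simp: x_def algebra_simps)
        also have "\<dots> = (\<Sum>j\<in>UNIV. ?b j * g $ j) + \<epsilon>"
          using b1 by (simp add: sum.distrib flip: sum_distrib_right)
        finally show ?thesis using gL gi xi by (simp add: pps_map_def LinF)
      next
        case (QuadF j k)
        have gq: "g $ i = g $ j * g $ k" using g(3)[of i] QuadF by simp
        have "a $ i \<le> y $ j * a $ k + a $ j * y $ k - y $ j * y $ k"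
          using ai[of i] QuadF by simp
        also have "\<dots> \<le> y $ j * (g $ k + m * v k) + (g $ j + m * v j) * y $ k - y $ j * y $ k"
          using ub yg(1) by (intro diff_right_mono add_mono mult_left_mono mult_right_mono) auto
        also have "\<dots> = g $ j * g $ k - (g $ j - y $ j) * (g $ k - y $ k)
            + m * (y $ j * v k + v j * y $ k)"
          by (simp add: algebra_simps)
        also have "\<dots> \<le> g $ j * g $ k + m * (g $ j * v k + v j * g $ k)"
        proof -
          have "0 \<le> (g $ j - y $ j) * (g $ k - y $ k)" using yg by simp
          moreover have "m * (y $ j * v k + v j * y $ k) \<le> m * (g $ j * v k + v j * g $ k)"
            using m yg v[of j] v[of k]
            by (intro mult_left_mono add_mono mult_right_mono) auto
          ultimately show ?thesis by linarith
        qed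
        also have "\<dots> < g $ i + m * v i"
        proof -
          have "v i = g $ j * v k + v j * g $ k + v j * v k"
            by (simp add: v_def gq algebra_simps)
          moreover have "0 < m * (v j * v k)" using m v by simp
          ultimately show ?thesis by (simp add: gq algebra_simps)
        qed
        finally show ?thesis using iS by simp
      next
        case (MinF j k)
        have gm: "g $ i = min (g $ j) (g $ k)" using g(3)[of i] MinF by simp
        have am: "a $ i \<le> a $ j" "a $ i \<le> a $ k" using ai[of i] MinF by auto
        have "\<gamma> + \<epsilon> \<le> x $ l" if "\<gamma> \<le> g $ l" "a $ i \<le> a $ l" for l
        proof (cases "\<gamma> = g $ l")
          case True
          then have "l \<in> T" using iS gi that(2) by (auto simp: T_def S v_def)
          then show ?thesis using True by (simp add: x_def)
        next
          case False
          then have "\<gamma> + \<epsilon> \<le> g $ l" using \<epsilon>k that(1) by simp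
          also have "\<dots> \<le> x $ l" using gx by (simp add: less_eq_vec_def)
          finally show ?thesis .
        qed
        then have "\<gamma> + \<epsilon> \<le> x $ j" "\<gamma> + \<epsilon> \<le> x $ k" using gm gi am by auto
        then show ?thesis using xi by (simp add: pps_map_def MinF)
      qed
    qed
  qed
  then have "x \<le> g" using gfp_cube(4)[OF P x0 x1] by (simp add: g_def)
  then have "x $ t \<le> g $ t" by (simp add: less_eq_vec_def)
  then show False using t \<epsilon> by (simp add: x_def)
qed

lemma linearization_halving:
  assumes P: "minPPS_SNF P" and y: "y \<le> gfp_cube P"
    and lam: "0 \<le> \<kappa>" "\<And>i. gfp_cube P $ i - y $ i \<le> \<kappa> * (1 - gfp_cube P $ i)"
  defines "a \<equiv> \<chi> i. gfp_cube P $ i - \<kappa> / 2 * (1 - gfp_cube P $ i)"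
  shows "a \<le> linearization P y a"
  unfolding less_eq_vec_def
proof
  fix i
  define g where "g = gfp_cube P"
  define v where "v i = 1 - g $ i" for i
  define \<mu> where "\<mu> = \<kappa> / 2"
  have g: "0 \<le> g $ i" "g $ i \<le> 1" "eval_form (P i) g = g $ i" for i
    using gfp_cube[OF P] by (auto simp: g_def less_eq_vec_def pps_map_def vec_eq_iff)
  have a: "a $ i = g $ i - \<mu> * v i" for i by (simp add: a_def g_def v_def \<mu>_def)
  have \<mu>: "0 \<le> \<mu>" using lam(1) by (simp add: \<mu>_def)
  have v: "0 \<le> v i" for i using g(2) by (simp add: v_def)
  have yd: "0 \<le> g $ i - y $ i" "g $ i - y $ i \<le> 2 * \<mu> * v i" for i
    using y lam(2) by (auto simp: g_def less_eq_vec_def \<mu>_def v_def)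
  show "a $ i \<le> linearization P y a $ i"
  proof (cases "P i")
    case (LinF c \<alpha>)
    let ?b = "\<lambda>j. of_rat (\<alpha> j) :: real"
    have gL: "g $ i = of_rat c + (\<Sum>j\<in>UNIV. ?b j * g $ j)" using g(3)[of i] LinF by simp
    have "(\<Sum>j\<in>UNIV. ?b j * v j) = (\<Sum>j\<in>UNIV. ?b j) - (g $ i - of_rat c)"
      using gL by (simp add: v_def algebra_simps sum_subtractf)
    then have "(\<Sum>j\<in>UNIV. ?b j * v j) \<le> v i"
      using LinF_of_rat(3)[OF P LinF] by (simp add: v_def)
    then have "\<mu> * (\<Sum>j\<in>UNIV. ?b j * v j) \<le> \<mu> * v i" using \<mu> by (rule mult_left_mono)
    moreover have "linearization P y a $ i = g $ i - \<mu> * (\<Sum>j\<in>UNIV. ?b j * v j)"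
      by (simp add: linearization_def LinF a gL right_diff_distrib sum_subtractf
          sum_distrib_left mult.left_commute)
    ultimately show ?thesis by (simp add: a)
  next
    case (QuadF j k)
    have gq: "g $ i = g $ j * g $ k" using g(3)[of i] QuadF by simp
    have d: "\<bar>a $ l - y $ l\<bar> \<le> \<mu> * v l" for l
      using yd[of l] unfolding a by (simp add: abs_le_iff)
    have "(a $ j - y $ j) * (a $ k - y $ k) \<le> \<bar>a $ j - y $ j\<bar> * \<bar>a $ k - y $ k\<bar>"
      by (simp flip: abs_mult)
    also have "\<dots> \<le> (\<mu> * v j) * (\<mu> * v k)" using d \<mu> v by (intro mult_mono) auto
    finally have 1: "(a $ j - y $ j) * (a $ k - y $ k) \<le> (\<mu> * v j) * (\<mu> * v k)" .
    have "linearization P y a $ i = a $ j * a $ k - (a $ j - y $ j) * (a $ k - y $ k)"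
      by (simp add: linearization_def QuadF algebra_simps)
    moreover have "a $ j * a $ k = g $ i - \<mu> * (v j * g $ k + g $ j * v k) + (\<mu> * v j) * (\<mu> * v k)"
      by (simp add: a gq algebra_simps)
    moreover have "v i = v j * g $ k + g $ j * v k + v j * v k"
      by (simp add: v_def gq algebra_simps)
    then have "\<mu> * (v j * g $ k + g $ j * v k) \<le> \<mu> * v i"
      using \<mu> v by (intro mult_left_mono) auto
    ultimately show ?thesis using 1 unfolding a[of i] by linarith
  next
    case (MinF j k)
    have "g $ i \<le> g $ j" "g $ i \<le> g $ k" using g(3)[of i] MinF by auto
    then have "\<mu> * v j \<le> \<mu> * v i" "\<mu> * v k \<le> \<mu> * v i"
      using \<mu> by (auto simp: v_def intro!: mult_left_mono)
    then show ?thesis using \<open>g $ i \<le> g $ j\<close> \<open>g $ i \<le> g $ k\<close>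
      by (simp add: linearization_def MinF a)
  qed
qed

lemma gnm_I_bounds:
  assumes P: "minPPS_SNF P" and lt1: "\<forall>i. gfp_cube P $ i < 1"
    and y: "0 \<le> y" "y \<le> gfp_cube P"
    and lam: "0 \<le> \<kappa>" "\<And>i. gfp_cube P $ i - y $ i \<le> \<kappa> * (1 - gfp_cube P $ i)"
  shows "gnm_I P y $ i \<le> gfp_cube P $ i"
    "gfp_cube P $ i - gnm_I P y $ i \<le> \<kappa> / 2 * (1 - gfp_cube P $ i)"
proof -
  let ?A = "{a. a \<le> linearization P y a}"
  let ?a0 = "\<chi> i. gfp_cube P $ i - \<kappa> / 2 * (1 - gfp_cube P $ i)"
  have a0: "?a0 \<in> ?A" using linearization_halving[OF P y(2) lam] by simp
  have le: "a \<le> gfp_cube P" if "a \<in> ?A" for a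
    using linearization_postfixed_le_gfp_cube[OF P lt1 y] that by simp
  obtain s where ub: "\<And>a. a \<in> ?A \<Longrightarrow> a \<le> s"
    and least: "\<And>b. (\<And>a. a \<in> ?A \<Longrightarrow> a \<le> b) \<Longrightarrow> s \<le> b"
    using vec_lub_exists[of ?A "gfp_cube P"] a0 le by blast
  have s: "s \<in> ?A"
  proof -
    have "s \<le> linearization P y s"
    proof (rule least)
      fix a assume a: "a \<in> ?A"
      then have "linearization P y a \<le> linearization P y s"
        using linearization_mono[OF P y(1)] ub by blast
      then show "a \<le> linearization P y s" using a order_trans by blast
    qed
    then show ?thesis by simp
  qed
  have max: "(\<Sum>i\<in>UNIV. a $ i) \<le> (\<Sum>i\<in>UNIV. s $ i)" if "a \<in> ?A" for a
    using ub[OF that] by (intro sum_mono) (auto simp: less_eq_vec_def)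
  have "gnm_I P y = s" unfolding gnm_I_def
  proof (rule the_equality)
    show "is_arg_max (\<lambda>a. \<Sum>i\<in>UNIV. a $ i) (\<lambda>a. a \<le> linearization P y a) s"
      using s max by (auto simp: is_arg_max_def not_less)
  next
    fix a assume "is_arg_max (\<lambda>a. \<Sum>i\<in>UNIV. a $ i) (\<lambda>a. a \<le> linearization P y a) a"
    then have a: "a \<in> ?A" "\<not> (\<Sum>i\<in>UNIV. a $ i) < (\<Sum>i\<in>UNIV. s $ i)"
      using s by (auto simp: is_arg_max_def)
    then have "(\<Sum>i\<in>UNIV. s $ i - a $ i) = 0" using max[OF a(1)] by (simp add: sum_subtractf)
    moreover have "0 \<le> s $ i - a $ i" for i using ub[OF a(1)] by (simp add: less_eq_vec_def)
    ultimately have "s $ i - a $ i = 0" for i by (subst (asm) sum_nonneg_eq_0_iff) auto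
    then show "a = s" by (simp add: vec_eq_iff)
  qed
  moreover have "s $ i \<le> gfp_cube P $ i" "?a0 $ i \<le> s $ i"
    using le[OF s] ub[OF a0] by (simp_all add: less_eq_vec_def)
  ultimately show "gnm_I P y $ i \<le> gfp_cube P $ i"
    "gfp_cube P $ i - gnm_I P y $ i \<le> \<kappa> / 2 * (1 - gfp_cube P $ i)" by simp_all
qed

lemma round_down_bounds:
  assumes "0 \<le> t"
  shows "0 \<le> round_down h t" "round_down h t \<le> t" "t - (1/2) ^ h \<le> round_down h t"
proof -
  let ?u = "2 powr (- real h)"
  have u: "?u = (1/2) ^ h" by (simp add: powr_minus powr_realpow power_divide inverse_eq_divide)
  have u0: "0 < ?u" by simp
  define n where "n = nat \<lfloor>t / ?u\<rfloor>"
  have "0 \<le> t / ?u" using assms by simp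
  then have n: "real n = of_int \<lfloor>t / ?u\<rfloor>" by (simp add: n_def)
  have "real n \<le> t / ?u" "t / ?u < real n + 1" unfolding n by linarith+
  then have nt: "real n * ?u \<le> t" "t < (real n + 1) * ?u"
    using u0 by (simp_all only: pos_le_divide_eq pos_divide_less_eq)
  have "round_down h t = real n * ?u" unfolding round_down_def
  proof (rule Greatest_equality)
    show "(\<exists>m. real n * ?u = real m * ?u) \<and> real n * ?u \<le> t" using nt(1) by blast
  next
    fix r assume "(\<exists>m. r = real m * ?u) \<and> r \<le> t"
    then obtain m where m: "r = real m * ?u" "r \<le> t" by blast
    then have "real m * ?u < (real n + 1) * ?u" using nt(2) by linarith
    then have "real m < real n + 1" using u0 by (simp only: mult_less_cancel_right_pos)
    then have "real m \<le> real n" by simp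
    then show "r \<le> real n * ?u" unfolding m using u0 by (intro mult_right_mono) auto
  qed
  then show "0 \<le> round_down h t" "round_down h t \<le> t" "t - (1/2) ^ h \<le> round_down h t"
    using nt u0 unfolding u by (auto simp: algebra_simps)
qed

lemma gnm_error:
  assumes P: "minPPS_SNF P" and lt1: "\<forall>i. gfp_cube P $ i < 1"
    and N: "\<And>i. (1/2) ^ N \<le> 1 - gfp_cube P $ i"
  shows "0 \<le> gnm P h k" "gnm P h k \<le> gfp_cube P"
    "\<And>i. gfp_cube P $ i - gnm P h k $ i \<le> 2 ^ N * ((1/2) ^ k + 2 * (1/2) ^ h) * (1 - gfp_cube P $ i)"
proof -
  let ?g = "gfp_cube P"
  have g: "0 \<le> ?g $ i" "?g $ i \<le> 1" for i using gfp_cube[OF P] by (auto simp: less_eq_vec_def)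
  have N': "1 \<le> 2 ^ N * (1 - ?g $ i)" for i
    using mult_left_mono[OF N[of i], of "2 ^ N"] by (simp add: power_divide)
  have "0 \<le> gnm P h k \<and> gnm P h k \<le> ?g \<and>
    (\<forall>i. ?g $ i - gnm P h k $ i \<le> 2 ^ N * ((1/2) ^ k + 2 * (1/2) ^ h) * (1 - ?g $ i))"
  proof (induction k)
    case 0
    have "?g $ i \<le> 2 ^ N * (1 + 2 * (1/2) ^ h) * (1 - ?g $ i)" for i
    proof -
      have "0 \<le> 2 ^ N * (1 - ?g $ i) * (2 * (1/2) ^ h)" using g by simp
      moreover have "2 ^ N * (1 + 2 * (1/2) ^ h) * (1 - ?g $ i)
          = 2 ^ N * (1 - ?g $ i) + 2 ^ N * (1 - ?g $ i) * (2 * (1/2) ^ h)"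
        by (simp add: algebra_simps)
      ultimately show ?thesis using N'[of i] g(2)[of i] by linarith
    qed
    then show ?case using g by (simp add: less_eq_vec_def)
  next
    case (Suc k)
    let ?y = "gnm P h k"
    let ?l = "2 ^ N * ((1/2) ^ k + 2 * (1/2) ^ h) :: real"
    let ?x = "gnm P h (Suc k)"
    have I: "gnm_I P ?y $ i \<le> ?g $ i" "?g $ i - gnm_I P ?y $ i \<le> ?l / 2 * (1 - ?g $ i)" for i
      using gnm_I_bounds[OF P lt1, of ?y ?l i] Suc.IH by auto
    have x: "0 \<le> ?x $ i" "?x $ i \<le> max 0 (gnm_I P ?y $ i)"
      "max 0 (gnm_I P ?y $ i) - (1/2) ^ h \<le> ?x $ i" for i
      using round_down_bounds[of "max 0 (gnm_I P ?y $ i)" h] by auto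
    have "?x $ i \<le> ?g $ i" for i using x(2)[of i] I(1)[of i] g(1)[of i] by linarith
    moreover have "?g $ i - ?x $ i \<le> 2 ^ N * ((1/2) ^ Suc k + 2 * (1/2) ^ h) * (1 - ?g $ i)" for i
    proof -
      have "?g $ i - ?x $ i \<le> ?l / 2 * (1 - ?g $ i) + (1/2) ^ h"
        using x(3)[of i] I(2)[of i] by linarith
      moreover have "(1/2) ^ h \<le> (1/2) ^ h * (2 ^ N * (1 - ?g $ i))"
        using mult_left_mono[OF N'[of i], of "(1/2) ^ h"] by simp
      moreover have "2 ^ N * ((1/2) ^ Suc k + 2 * (1/2) ^ h) * (1 - ?g $ i)
          = ?l / 2 * (1 - ?g $ i) + (1/2) ^ h * (2 ^ N * (1 - ?g $ i))"
        by (simp add: field_simps)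
      ultimately show ?thesis by linarith
    qed
    ultimately show ?case using x(1) by (simp add: less_eq_vec_def del: gnm.simps)
  qed
  then show "0 \<le> gnm P h k" "gnm P h k \<le> ?g"
    "\<And>i. ?g $ i - gnm P h k $ i \<le> 2 ^ N * ((1/2) ^ k + 2 * (1/2) ^ h) * (1 - ?g $ i)" by auto
qed

theorem theorem7p1:
  fixes P :: "'n::finite \<Rightarrow> 'n snf_form" and j h :: nat
  assumes "minPPS_SNF P"
    and "\<forall>i. gfp_cube P $ i < 1"
    and "j > 0"
    and "h = j + 2 + 4 * enc_size P"
  shows "infnorm (gfp_cube P - gnm P h h) \<le> 2 powr (- real j)"
proof -
  let ?N = "4 * enc_size P" and ?g = "gfp_cube P" and ?x = "gnm P h h"
  have "(1/2::real) ^ ?N \<le> (1/2) ^ enc_size P" by (intro power_decreasing) auto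
  then have N: "(1/2) ^ ?N \<le> 1 - ?g $ i" for i
    using gfp_cube_gap[OF assms(1,2), of i] by linarith
  have "\<bar>(?g - ?x) $ i\<bar> \<le> 2 powr (- real j)" for i
  proof -
    have g: "0 \<le> ?g $ i" using gfp_cube(1)[OF assms(1)] by (simp add: less_eq_vec_def)
    have x: "?x $ i \<le> ?g $ i" using gnm_error(2)[OF assms(1,2) N] by (simp add: less_eq_vec_def)
    have "2 ^ ?N * ((1/2) ^ h + 2 * (1/2) ^ h) = 3/4 * (1/2::real) ^ j"
      unfolding assms(4) by (simp add: power_add power_divide field_simps)
    then have "?g $ i - ?x $ i \<le> 3/4 * (1/2) ^ j * (1 - ?g $ i)"
      using gnm_error(3)[OF assms(1,2) N, where h = h and k = h and i = i] by (simp only:)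
    also have "\<dots> \<le> 3/4 * (1/2) ^ j" using g by (intro mult_left_le) auto
    also have "\<dots> \<le> (1/2) ^ j" by simp
    also have "\<dots> = 2 powr (- real j)"
      by (simp add: powr_minus powr_realpow power_divide inverse_eq_divide)
    finally show ?thesis using x by simp
  qed
  then show ?thesis unfolding infnorm_cart by (intro cSup_least) auto
qed

end
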